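(* Let $n\ge 0$ be an integer and let $a,b>0$. (i) For all $x$, $$(-1)^nJ_n(-x|a,b)=J_n(x|b,a),\qquad J_n(2x-1|a,b)=K_n(x|a,b),\qquad (-1)^nK_n(x|a,b)=K_n(1-x|b,a).$$ (ii) If additionally $c>0$, then $$\int_0^1K_n(x|a,c)\,f(x|a,b)\,dx=\frac{(a)^{(n)}(c-b)^{(n)}}{n!\,(a+b)^{(n)}},$$ $$\int_0^1K_n(x|c,b)\,f(x|a,b)\,dx=(-1)^n\frac{(b)^{(n)}(c-a)^{(n)}}{n!\,(a+b)^{(n)}}.$$ (iii) $$K_n(0|a,b)=\frac{(-1)^n}{n!}(a)^{(n)},\qquad K_n(1|a,b)=\frac{1}{n!}(b)^{(n)}.$$
   Context: Rising factorial: $(x)^{(n)}=x(x+1)\cdots(x+n-1)$, $(x)^{(0)}=1$. Beta density on $[0,1]$: $f(x|a,b)=x^{a-1}(1-x)^{b-1}/B(a,b)$ for $0\le x\le 1$ and $0$ otherwise, where $B(a,b)$ is Euler's beta function ($a,b>0$). Jacobi polynomials in the paper's normalization: $$J_n(x|a,b)=\frac{1}{n!}\sum_{m=0}^n\binom{n}{m}(a+b+n-1)^{(m)}(b+m)^{(n-m)}\frac{(x-1)^m}{2^m},$$ $$K_n(x|a,b)=\frac{1}{n!}\sum_{m=0}^n\binom{n}{m}(a+b+n-1)^{(m)}(b+m)^{(n-m)}(x-1)^m.$$ *)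

theory Defs
  imports "HOL-Analysis.Analysis"
begin

text \<open>
  The rising factorial \<open>(x)\<^sup>(\<^sup>n\<^sup>)\<close> is \<^const>\<open>pochhammer\<close>.
\<close>

text \<open>
  Pitfall: \<open>0 powr e = 0\<close> for every \<open>e\<close>, so the value below at \<open>x = 0\<close> and \<open>x = 1\<close> is \<open>0\<close>,
  also when the exponent is \<open>0\<close> or negative. Only integrals of the density are considered, and
  these do not depend on its values at the two endpoints.
\<close>

definition beta_density :: "real \<Rightarrow> real \<Rightarrow> real \<Rightarrow> real" where
  "beta_density a b x =
     (if 0 \<le> x \<and> x \<le> 1 then x powr (a - 1) * (1 - x) powr (b - 1) / Beta a b else 0)"

text \<open>
  The normalization is not the classical one: \<open>jacobi_J n a b\<close> is the classical
  \<open>P\<^sub>n\<close> with parameters \<open>b - 1\<close> (at the endpoint \<open>1\<close>) and \<open>a - 1\<close> (at the endpoint \<open>-1\<close>);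
  \<open>jacobi_K\<close> is the version shifted to \<open>[0, 1]\<close>.
\<close>

definition jacobi_J :: "nat \<Rightarrow> real \<Rightarrow> real \<Rightarrow> real \<Rightarrow> real" where
  "jacobi_J n a b x =
     1 / fact n * (\<Sum>m = 0..n. real (n choose m) * pochhammer (a + b + real n - 1) m
       * pochhammer (b + real m) (n - m) * ((x - 1) ^ m / 2 ^ m))"

definition jacobi_K :: "nat \<Rightarrow> real \<Rightarrow> real \<Rightarrow> real \<Rightarrow> real" where
  "jacobi_K n a b x =
     1 / fact n * (\<Sum>m = 0..n. real (n choose m) * pochhammer (a + b + real n - 1) m
       * pochhammer (b + real m) (n - m) * (x - 1) ^ m)"

end

theory Submission
  imports Defs
begin

text \<open>
  Everything rests on the Chu-Vandermonde identity. Expanding \<open>(x - 1) ^ m\<close> in powers of \<open>x\<close>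
  and summing each coefficient with it gives the reflection formula for \<open>K\<^sub>n\<close>.
  For the integrals, the \<open>m\<close>-th moment of \<open>1 - x\<close> under the beta density is
  \<open>(b)\<^sup>(\<^sup>m\<^sup>) / (a + b)\<^sup>(\<^sup>m\<^sup>)\<close>. When the polynomial shares the parameter \<open>b\<close> with the density, the
  numerator merges with the coefficient \<open>(b + m)\<^sup>(\<^sup>n\<^sup>-\<^sup>m\<^sup>)\<close> into \<open>(b)\<^sup>(\<^sup>n\<^sup>)\<close>, so that Chu-Vandermonde
  suffices again. When it shares \<open>a\<close>, the sum at hand would be of Saalschuetz type; this is
  avoided by reflecting \<open>x \<mapsto> 1 - x\<close> first.
\<close>

section \<open>Alternating Chu-Vandermonde sums\<close>

text \<open>Reversing the product and negating each factor replaces the base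
  \<open>b + of_nat m\<close> by one that is free of \<open>m\<close>, as Chu-Vandermonde
  requires.\<close>

lemma pochhammer_shift_reflect:
  fixes b :: "'a::comm_ring_1"
  assumes "m \<le> n"
  shows "pochhammer (b + of_nat m) (n - m)
    = (-1) ^ (n - m) * pochhammer (1 - b - of_nat n) (n - m)"
  using pochhammer_minus'[of "b + of_nat n - 1" "n - m"] assms
  by (simp add: of_nat_diff algebra_simps)

text \<open>After the reversal the signs combine to \<open>(-1) ^ n\<close> in every term, leaving a
  plain Chu-Vandermonde sum; a second reversal turns its base \<open>s + 1 - b - n\<close> into
  \<open>b - s\<close>.\<close>

lemma alternating_pochhammer_binomial_sum:
  fixes s b :: "'a::comm_ring_1"
  shows "(\<Sum>m\<le>n. of_nat (n choose m) * pochhammer s m * pochhammer (b + of_nat m) (n - m)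
    * (-1) ^ m) = pochhammer (b - s) n"
proof -
  have "(\<Sum>m\<le>n. of_nat (n choose m) * pochhammer s m * pochhammer (b + of_nat m) (n - m)
      * (-1) ^ m)
    = (\<Sum>m\<le>n. (-1) ^ n
        * (of_nat (n choose m) * pochhammer s m * pochhammer (1 - b - of_nat n) (n - m)))"
  proof (rule sum.cong[OF refl])
    fix m assume "m \<in> {..n}"
    hence m: "m \<le> n" by simp
    have sg: "(-1) ^ n = (-1) ^ (n - m) * (-1 :: 'a) ^ m"
      using m by (simp flip: power_add)
    show "of_nat (n choose m) * pochhammer s m * pochhammer (b + of_nat m) (n - m) * (-1) ^ m
      = (-1) ^ n
        * (of_nat (n choose m) * pochhammer s m * pochhammer (1 - b - of_nat n) (n - m))"
      unfolding pochhammer_shift_reflect[OF m] sg by (simp add: mult_ac)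
  qed
  also have "\<dots> = (-1) ^ n * pochhammer (s + (1 - b - of_nat n)) n"
    by (simp add: pochhammer_binomial_sum sum_distrib_left)
  also have "\<dots> = pochhammer (b - s) n"
    using pochhammer_minus[of "s - b" n] by (simp add: algebra_simps)
  finally show ?thesis .
qed

section \<open>Reflection and endpoint values of the polynomials\<close>

text \<open>Since \<open>a + b + real n - 1\<close> is symmetric in \<open>a\<close> and
  \<open>b\<close>, and \<open>(1 - x) - 1 = - x\<close>, it suffices to recentre the left side from
  1 to 0.\<close>

lemma jacobi_K_reflect: "(-1) ^ n * jacobi_K n a b x = jacobi_K n b a (1 - x)"
proof -
  define s where "s = a + b + real n - 1"
  define c where "c = (\<lambda>m. real (n choose m) * pochhammer s m * pochhammer (b + real m) (n - m))"
  \<comment> \<open>The coefficient of \<open>x ^ k\<close>. With \<open>m = j + k\<close>,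
    trinomial revision and splitting \<open>pochhammer s (j + k)\<close> leave an alternating sum of
    order \<open>n - k\<close> with bases \<open>s + k\<close> and \<open>b + k\<close>.\<close>
  have coeff: "(\<Sum>m=k..n. c m * (real (m choose k) * (-1) ^ (m - k)))
      = (-1) ^ (n - k) * (real (n choose k) * pochhammer s k * pochhammer (a + real k) (n - k))"
    if k: "k \<le> n" for k
  proof -
    have "(\<Sum>m=k..n. c m * (real (m choose k) * (-1) ^ (m - k)))
      = (\<Sum>j\<le>n - k. c (j + k) * (real ((j + k) choose k) * (-1) ^ j))"
      using sum.shift_bounds_cl_nat_ivl
        [of "\<lambda>m. c m * (real (m choose k) * (-1) ^ (m - k))" 0 k "n - k"] k
      by (simp add: atLeast0AtMost)
    also have "\<dots> = (\<Sum>j\<le>n - k. real (n choose k) * pochhammer s k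
        * (real ((n - k) choose j) * pochhammer (s + real k) j
          * pochhammer (b + real k + real j) (n - k - j) * (-1) ^ j))"
    proof (rule sum.cong[OF refl])
      fix j assume "j \<in> {..n - k}"
      hence j: "j + k \<le> n" using k by auto
      have "(n choose (j + k)) * ((j + k) choose k) = (n choose k) * ((n - k) choose j)"
        using choose_mult[of k "j + k" n] j by simp
      hence ch: "real (n choose (j + k)) * real ((j + k) choose k)
          = real (n choose k) * real ((n - k) choose j)"
        by (metis of_nat_mult)
      have ps: "pochhammer s (j + k) = pochhammer s k * pochhammer (s + real k) j"
        by (simp add: add.commute[of j] pochhammer_product')
      have "c (j + k) * (real ((j + k) choose k) * (-1) ^ j)
        = (real (n choose (j + k)) * real ((j + k) choose k)) * pochhammer s (j + k)
          * pochhammer (b + real k + real j) (n - k - j) * (-1) ^ j"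
        by (simp add: c_def mult_ac add_ac)
      thus "c (j + k) * (real ((j + k) choose k) * (-1) ^ j)
        = real (n choose k) * pochhammer s k
          * (real ((n - k) choose j) * pochhammer (s + real k) j
          * pochhammer (b + real k + real j) (n - k - j) * (-1) ^ j)"
        unfolding ch ps by (simp add: mult_ac)
    qed
    also have "\<dots> = real (n choose k) * pochhammer s k * pochhammer (b - s) (n - k)"
      using alternating_pochhammer_binomial_sum[of "n - k" "s + real k" "b + real k"]
      by (simp flip: sum_distrib_left)
    \<comment> \<open>Here the parameters trade places: \<open>b\<close> cancels, and reversing the
      product of base \<open>1 - a - n\<close> brings in \<open>a + k\<close>.\<close>
    also have "b - s = 1 - a - real n"
      by (simp add: s_def)
    also have "real (n choose k) * pochhammer s k * pochhammer (1 - a - real n) (n - k)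
      = (-1) ^ (n - k) * (real (n choose k) * pochhammer s k * pochhammer (a + real k) (n - k))"
      by (simp add: pochhammer_shift_reflect[OF k] mult_ac)
    finally show ?thesis .
  qed
  have "(\<Sum>m\<le>n. c m * (x - 1) ^ m)
    = (\<Sum>m\<le>n. \<Sum>k\<le>m. c m * (real (m choose k) * (-1) ^ (m - k)) * x ^ k)"
    using binomial_ring[of x "-1"] by (simp add: sum_distrib_left mult_ac)
  also have "\<dots> = (\<Sum>k\<le>n. \<Sum>m=k..n. c m * (real (m choose k) * (-1) ^ (m - k)) * x ^ k)"
  proof -
    have "{k \<in> {..n}. k \<le> m} = {..m}" if "m \<le> n" for m
      using that by auto
    moreover have "{m \<in> {..n}. k \<le> m} = {k..n}" for k
      by auto
    ultimately show ?thesis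
      using sum.swap_restrict[of "{..n}" "{..n}"
          "\<lambda>m k. c m * (real (m choose k) * (-1) ^ (m - k)) * x ^ k" "\<lambda>m k. k \<le> m"]
      by simp
  qed
  also have "\<dots> = (\<Sum>k\<le>n. (-1) ^ (n - k)
      * (real (n choose k) * pochhammer s k * pochhammer (a + real k) (n - k)) * x ^ k)"
    by (rule sum.cong[OF refl]) (simp add: coeff flip: sum_distrib_right)
  finally have expand: "(\<Sum>m\<le>n. c m * (x - 1) ^ m) = \<dots>" .
  \<comment> \<open>As \<open>(-1) ^ (n - k)\<close> squares to 1, the sign left over is
    \<open>(-1) ^ k\<close>, which turns \<open>x ^ k\<close> into \<open>(- x) ^ k\<close>.\<close>
  have "(-1) ^ n * (\<Sum>m\<le>n. c m * (x - 1) ^ m)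
    = (\<Sum>k\<le>n. real (n choose k) * pochhammer s k * pochhammer (a + real k) (n - k) * (- x) ^ k)"
    unfolding expand sum_distrib_left
  proof (rule sum.cong[OF refl])
    fix k assume "k \<in> {..n}"
    hence "(-1) ^ n = (-1) ^ (n - k) * (-1 :: real) ^ k"
      by (simp flip: power_add)
    hence sg: "(-1) ^ n * (-1) ^ (n - k) = (-1 :: real) ^ k"
      by (simp add: mult_ac)
    have "(-1) ^ n * ((-1) ^ (n - k)
        * (real (n choose k) * pochhammer s k * pochhammer (a + real k) (n - k)) * x ^ k)
      = ((-1) ^ n * (-1) ^ (n - k)) * (real (n choose k) * pochhammer s k
        * pochhammer (a + real k) (n - k) * x ^ k)"
      by (simp only: mult_ac)
    thus "(-1) ^ n * ((-1) ^ (n - k)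
        * (real (n choose k) * pochhammer s k * pochhammer (a + real k) (n - k)) * x ^ k)
      = real (n choose k) * pochhammer s k * pochhammer (a + real k) (n - k) * (- x) ^ k"
      by (simp only: sg power_minus[of x] mult_ac)
  qed
  thus ?thesis
    by (simp add: jacobi_K_def c_def s_def atLeast0AtMost add_ac)
qed

text \<open>The affine map from [-1, 1] onto [0, 1] reduces every claim on \<open>jacobi_J\<close>
  to one on \<open>jacobi_K\<close>.\<close>

lemma jacobi_J_eq_jacobi_K: "jacobi_J n a b x = jacobi_K n a b ((x + 1) / 2)"
proof -
  have "(x + 1) / 2 - 1 = (x - 1) / 2"
    by (simp add: field_simps)
  thus ?thesis
    by (simp add: jacobi_J_def jacobi_K_def power_divide)
qed

lemma jacobi_K_1: "jacobi_K n a b 1 = pochhammer b n / fact n"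
  by (simp add: jacobi_K_def power_0_left if_distrib sum.delta cong: if_cong)

section \<open>Moments of the beta density\<close>

lemma beta_density_commute: "beta_density a b (1 - x) = beta_density b a x"
  by (simp add: beta_density_def Beta_commute mult_ac)

lemma Beta_shift_left:
  fixes a b :: real
  assumes "a > 0" "b > 0"
  shows "Beta (a + real m) b = Beta a b * pochhammer a m / pochhammer (a + b) m"
proof -
  \<comment> \<open>Positive arguments avoid the poles of Gamma, so both rising factorials are
    quotients of Gamma values.\<close>
  have "x \<notin> \<int>\<^sub>\<le>\<^sub>0" if "x > 0" for x :: real
    using that by (auto elim!: nonpos_Ints_cases)
  thus ?thesis
    using assms by (simp add: Beta_def pochhammer_Gamma Gamma_eq_zero_iff add_ac)
qed

lemma has_bochner_integral_reflect_Icc: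
  fixes f :: "real \<Rightarrow> real"
  assumes "has_bochner_integral lborel (\<lambda>x. indicator {0..1} x *\<^sub>R f x) I"
  shows "has_bochner_integral lborel (\<lambda>x. indicator {0..1} x *\<^sub>R f (1 - x)) I"
proof -
  have "indicator {0..1} (1 - x) = (indicator {0..1} x :: real)" for x :: real
    by (auto simp: indicator_def)
  thus ?thesis
    using lborel_has_bochner_integral_real_affine_iff
      [of "-1" "\<lambda>x. indicator {0..1} x *\<^sub>R f x" I 1] assms
    by simp
qed

text \<open>The factor \<open>x ^ m\<close> raises the parameter \<open>a\<close> to
  \<open>a + m\<close>, so the moment is a quotient of two Beta values.\<close>

lemma beta_density_moment:
  assumes "a > 0" "b > 0"
  shows "has_bochner_integral lborel (\<lambda>x. indicator {0..1} x *\<^sub>R (x ^ m * beta_density a b x))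
    (pochhammer a m / pochhammer (a + b) m)"
proof -
  let ?g = "\<lambda>x::real. x powr (a + real m - 1) * (1 - x) powr (b - 1)"
  have am: "a + real m > 0" using assms by simp
  have int: "set_integrable lborel {0..1} ?g"
    using integrable_Beta[OF am \<open>b > 0\<close>] by simp
  have "(LBINT x:{0..1}. ?g x) = Beta (a + real m) b"
    using set_borel_integral_eq_integral(2)[OF int] has_integral_Beta_real[OF am \<open>b > 0\<close>]
    by (simp add: integral_unique)
  with int have "has_bochner_integral lborel (\<lambda>x. indicator {0..1} x *\<^sub>R ?g x)
      (Beta (a + real m) b)"
    by (simp add: has_bochner_integral_iff set_integrable_def set_lebesgue_integral_def)
  hence "has_bochner_integral lborel (\<lambda>x. (indicator {0..1} x *\<^sub>R ?g x) / Beta a b)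
      (Beta (a + real m) b / Beta a b)"
    by (rule has_bochner_integral_divide_zero)
  moreover have "(indicator {0..1} x *\<^sub>R ?g x) / Beta a b
      = indicator {0..1} x *\<^sub>R (x ^ m * beta_density a b x)" for x
  proof -
    have "a + real m - 1 = real m + (a - 1)"
      by simp
    hence "x powr (a + real m - 1) = x ^ m * x powr (a - 1)" if "x > 0"
      using that by (simp only: powr_add powr_realpow)
    \<comment> \<open>By \<open>0 powr e = 0\<close> both sides vanish, even for
      \<open>m = 0\<close>, so the integrands agree pointwise.\<close>
    moreover have "x = 0 \<Longrightarrow> x powr (a + real m - 1) = x ^ m * x powr (a - 1)"
      by simp
    ultimately show ?thesis
      by (cases "x = 0") (auto simp: beta_density_def indicator_def)
  qed
  moreover have "Beta a b \<noteq> 0"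
    using assms Gamma_real_pos[THEN less_imp_neq] by (simp add: Beta_def)
  ultimately show ?thesis
    by (simp add: Beta_shift_left assms)
qed

section \<open>Integrals of the polynomials against the density\<close>

lemma jacobi_K_beta_integral:
  assumes "a > 0" "b > 0"
  shows "has_bochner_integral lborel
    (\<lambda>x. indicator {0..1} x *\<^sub>R (jacobi_K n c b x * beta_density a b x))
    ((-1) ^ n * (pochhammer b n * pochhammer (c - a) n / (fact n * pochhammer (a + b) n)))"
proof -
  define k where "k = (\<lambda>m. real (n choose m) * pochhammer (c + b + real n - 1) m
      * pochhammer (b + real m) (n - m) * (-1) ^ m)"
  \<comment> \<open>Moments of \<open>1 - x\<close> are moments of \<open>x\<close> under the
    density with swapped parameters.\<close>
  have mom: "has_bochner_integral lborel
      (\<lambda>x. indicator {0..1} x *\<^sub>R ((1 - x) ^ m * beta_density a b x))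
      (pochhammer b m / pochhammer (a + b) m)" for m
    using has_bochner_integral_reflect_Icc[OF beta_density_moment[OF \<open>b > 0\<close> \<open>a > 0\<close>, of m]]
    by (simp add: beta_density_commute add_ac)
  have K: "jacobi_K n c b x = 1 / fact n * (\<Sum>m\<le>n. k m * (1 - x) ^ m)" for x
  proof -
    have "(x - 1) ^ m = (-1) ^ m * (1 - x) ^ m" for m
      by (metis minus_diff_eq power_minus)
    thus ?thesis
      by (simp add: jacobi_K_def k_def atLeast0AtMost mult_ac)
  qed
  have "has_bochner_integral lborel
      (\<lambda>x. 1 / fact n * (\<Sum>m\<le>n. k m *
        (indicator {0..1} x *\<^sub>R ((1 - x) ^ m * beta_density a b x))))
      (1 / fact n * (\<Sum>m\<le>n. k m * (pochhammer b m / pochhammer (a + b) m)))"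
    by (intro has_bochner_integral_mult_right has_bochner_integral_sum mom)
  moreover have "1 / fact n * (\<Sum>m\<le>n. k m *
        (indicator {0..1} x *\<^sub>R ((1 - x) ^ m * beta_density a b x)))
      = indicator {0..1} x *\<^sub>R (jacobi_K n c b x * beta_density a b x)" for x
    by (simp add: K sum_distrib_left sum_distrib_right mult_ac)
  moreover have "(\<Sum>m\<le>n. k m * (pochhammer b m / pochhammer (a + b) m))
      = (-1) ^ n * (pochhammer b n * pochhammer (c - a) n / pochhammer (a + b) n)"
  proof -
    have pos: "pochhammer (a + b) m > 0" for m
      using assms by (intro pochhammer_pos) simp
    \<comment> \<open>Extending each fraction by \<open>(a + b + m)^(n - m)\<close> makes the
      denominator \<open>(a + b)^(n)\<close> common to all terms and puts \<open>a + b\<close> in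
      the place of \<open>b\<close> in the alternating sum.\<close>
    have "(\<Sum>m\<le>n. k m * (pochhammer b m / pochhammer (a + b) m))
      = (\<Sum>m\<le>n. pochhammer b n / pochhammer (a + b) n
          * (real (n choose m) * pochhammer (c + b + real n - 1) m
            * pochhammer (a + b + real m) (n - m) * (-1) ^ m))"
    proof (rule sum.cong[OF refl])
      fix m assume "m \<in> {..n}"
      hence m: "m \<le> n" by simp
      have ne: "pochhammer (a + b + real m) (n - m) \<noteq> 0"
        using pos[of n] pochhammer_product[OF m, of "a + b"] by auto
      show "k m * (pochhammer b m / pochhammer (a + b) m)
        = pochhammer b n / pochhammer (a + b) n
          * (real (n choose m) * pochhammer (c + b + real n - 1) m
            * pochhammer (a + b + real m) (n - m) * (-1) ^ m)"
        using ne pos[of m]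
        unfolding k_def pochhammer_product[OF m, of b] pochhammer_product[OF m, of "a + b"]
        by (simp add: field_simps)
    qed
    also have "\<dots> = pochhammer b n / pochhammer (a + b) n
        * pochhammer (a + b - (c + b + real n - 1)) n"
      by (simp only: alternating_pochhammer_binomial_sum flip: sum_distrib_left)
    also have "a + b - (c + b + real n - 1) = - (c - a + real n - 1)"
      by simp
    also have "pochhammer (- (c - a + real n - 1)) n = (-1) ^ n * pochhammer (c - a) n"
      unfolding pochhammer_minus by simp
    finally show ?thesis by simp
  qed
  ultimately show ?thesis
    by (simp add: mult_ac)
qed

text \<open>Reflection swaps the parameters of polynomial and density alike, so the preceding
  integral applies with \<open>a\<close> and \<open>b\<close> interchanged; the two signs
  \<open>(-1) ^ n\<close> cancel.\<close>

lemma jacobi_K_beta_integral':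
  assumes "a > 0" "b > 0"
  shows "has_bochner_integral lborel
    (\<lambda>x. indicator {0..1} x *\<^sub>R (jacobi_K n a c x * beta_density a b x))
    (pochhammer a n * pochhammer (c - b) n / (fact n * pochhammer (a + b) n))"
proof -
  have K: "(-1) ^ n * jacobi_K n c a (1 - x) = jacobi_K n a c x" for x
    by (simp flip: jacobi_K_reflect[of n a c x])
  have "has_bochner_integral lborel
      (\<lambda>x. (-1) ^ n * (indicator {0..1} x *\<^sub>R (jacobi_K n c a (1 - x) * beta_density b a (1 - x))))
      ((-1) ^ n * ((-1) ^ n
        * (pochhammer a n * pochhammer (c - b) n / (fact n * pochhammer (b + a) n))))"
    using assms
    by (intro has_bochner_integral_mult_right has_bochner_integral_reflect_Icc
          jacobi_K_beta_integral)
  moreover have "(-1) ^ n * (indicator {0..1} x *\<^sub>R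
        (jacobi_K n c a (1 - x) * beta_density b a (1 - x)))
      = indicator {0..1} x *\<^sub>R (((-1) ^ n * jacobi_K n c a (1 - x)) * beta_density a b x)" for x
    by (simp add: beta_density_commute)
  ultimately show ?thesis
    by (simp only: K) (simp add: add.commute)
qed

text \<open>Integrability accompanies each integral because \<open>LBINT\<close> of a non-integrable
  function is 0 by convention.\<close>

theorem proposition1:
  fixes n :: nat and a b :: real
  assumes "a > 0" and "b > 0"
  shows
    "(\<forall>x::real.
        (-1) ^ n * jacobi_J n a b (- x) = jacobi_J n b a x
      \<and> jacobi_J n a b (2 * x - 1) = jacobi_K n a b x
      \<and> (-1) ^ n * jacobi_K n a b x = jacobi_K n b a (1 - x))
   \<and> (\<forall>c::real. c > 0 \<longrightarrow>
        set_integrable lborel {0..1} (\<lambda>x. jacobi_K n a c x * beta_density a b x)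
      \<and> (LBINT x:{0..1}. jacobi_K n a c x * beta_density a b x)
          = pochhammer a n * pochhammer (c - b) n / (fact n * pochhammer (a + b) n)
      \<and> set_integrable lborel {0..1} (\<lambda>x. jacobi_K n c b x * beta_density a b x)
      \<and> (LBINT x:{0..1}. jacobi_K n c b x * beta_density a b x)
          = (-1) ^ n * (pochhammer b n * pochhammer (c - a) n / (fact n * pochhammer (a + b) n)))
   \<and> jacobi_K n a b 0 = (-1) ^ n / fact n * pochhammer a n
   \<and> jacobi_K n a b 1 = 1 / fact n * pochhammer b n"
proof -
  \<comment> \<open>On [0, 1] the map \<open>x\<close> to \<open>- x\<close> becomes
    \<open>y\<close> to \<open>1 - y\<close>.\<close>
  have J: "(-1) ^ n * jacobi_J n a b (- x) = jacobi_J n b a x" for x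
  proof -
    have "1 - (- x + 1) / 2 = (x + 1) / 2"
      by (simp add: field_simps)
    thus ?thesis
      by (simp only: jacobi_J_eq_jacobi_K jacobi_K_reflect)
  qed
  have K0: "jacobi_K n a b 0 = (-1) ^ n / fact n * pochhammer a n"
    using jacobi_K_reflect[of n b a 1] by (simp add: jacobi_K_1)
  show ?thesis
    using J K0 jacobi_K_beta_integral[OF assms] jacobi_K_beta_integral'[OF assms]
    by (simp add: jacobi_J_eq_jacobi_K[of n a b "2 * _ - 1"] jacobi_K_reflect jacobi_K_1
          has_bochner_integral_iff set_integrable_def set_lebesgue_integral_def)
qed

end
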